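(* Let $\Lambda$ be an Artin algebra, let $M$ be an indecomposable $\Lambda$-module and let $P_1\xrightarrow{f}P_0\xrightarrow{\sigma}M\to 0$ be a minimal projective presentation of $M$. Then: (1) the morphism $(0,\sigma):(P_1\xrightarrow{f}P_0)\to(0\to M)$ is a right minimal $\mathcal{P}(\Lambda)$-approximation; (2) the morphism $(\sigma,\sigma):(P_0\xrightarrow{1}P_0)\to(M\xrightarrow{1}M)$ is a right minimal $\mathcal{P}(\Lambda)$-approximation; (3) the morphism $(\sigma,0):(P_0\to 0)\to(M\to 0)$ is a right minimal $\mathcal{P}(\Lambda)$-approximation.
   Context: $\mathrm{mod}\text{-}\Lambda$ is the category of finitely generated $\Lambda$-modules; modules are finitely generated. $\mathcal{H}(\Lambda)$ is the morphism category of $\mathrm{mod}\text{-}\Lambda$: objects are morphisms $f:X\to Y$ in $\mathrm{mod}\text{-}\Lambda$, and a morphism from $(X\xrightarrow{f}Y)$ to $(X'\xrightarrow{f'}Y')$ is a pair $(\sigma_1,\sigma_2)$ with $\sigma_1:X\to X'$, $\sigma_2:Y\to Y'$ and $\sigma_2f=f'\sigma_1$. $\mathcal{P}(\Lambda)$ is the full subcategory of $\mathcal{H}(\Lambda)$ of objects $(P\xrightarrow{f}Q)$ with $P,Q$ projective. A right $\mathcal{P}(\Lambda)$-approximation of an object $\mathrm{X}$ is a morphism $\theta:\mathrm{P}\to\mathrm{X}$ with $\mathrm{P}\in\mathcal{P}(\Lambda)$ through which every morphism from an object of $\mathcal{P}(\Lambda)$ to $\mathrm{X}$ factors; it is (right)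 minimal if every endomorphism $\gamma$ of $\mathrm{P}$ with $\theta\gamma=\theta$ is an automorphism. *)

theory Defs
  imports "HOL-Algebra.Module" "HOL-Algebra.Ideal"
begin

section \<open>Artin algebras and finitely generated right modules\<close>

text \<open>
  Modules use the record type \<open>module\<close> of HOL-Algebra (its fields \<open>mult\<close> and \<open>one\<close> play
  no role); the locale \<open>module\<close> of HOL-Algebra is restricted to commutative scalars.
  In a right module, \<open>a \<odot> x\<close> stands for \<open>x \<cdot> a\<close>.
\<close>

locale right_module = R?: ring R + M?: abelian_group M
  for R :: "('a, 'z) ring_scheme" (structure) and M :: "('a, 'b) module" (structure) +
  assumes smult_closed [simp, intro]:
      "\<lbrakk>a \<in> carrier R; x \<in> carrier M\<rbrakk> \<Longrightarrow> a \<odot>\<^bsub>M\<^esub> x \<in> carrier M"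
    and smult_l_distr:
      "\<lbrakk>a \<in> carrier R; b \<in> carrier R; x \<in> carrier M\<rbrakk> \<Longrightarrow>
      (a \<oplus> b) \<odot>\<^bsub>M\<^esub> x = a \<odot>\<^bsub>M\<^esub> x \<oplus>\<^bsub>M\<^esub> b \<odot>\<^bsub>M\<^esub> x"
    and smult_r_distr:
      "\<lbrakk>a \<in> carrier R; x \<in> carrier M; y \<in> carrier M\<rbrakk> \<Longrightarrow>
      a \<odot>\<^bsub>M\<^esub> (x \<oplus>\<^bsub>M\<^esub> y) = a \<odot>\<^bsub>M\<^esub> x \<oplus>\<^bsub>M\<^esub> a \<odot>\<^bsub>M\<^esub> y"
    and smult_assoc_right:
      "\<lbrakk>a \<in> carrier R; b \<in> carrier R; x \<in> carrier M\<rbrakk> \<Longrightarrow>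
      (a \<otimes> b) \<odot>\<^bsub>M\<^esub> x = b \<odot>\<^bsub>M\<^esub> (a \<odot>\<^bsub>M\<^esub> x)"
    and smult_one [simp]:
      "x \<in> carrier M \<Longrightarrow> \<one> \<odot>\<^bsub>M\<^esub> x = x"

definition finitely_generated :: "('a, 'z) ring_scheme \<Rightarrow> ('a, 'b) module \<Rightarrow> bool" where
  "finitely_generated R M \<longleftrightarrow>
     (\<exists>S. finite S \<and> S \<subseteq> carrier M \<and>
        (\<forall>x\<in>carrier M. \<exists>c\<in>S \<rightarrow> carrier R. x = (\<Oplus>\<^bsub>M\<^esub>s\<in>S. c s \<odot>\<^bsub>M\<^esub> s)))"

definition artinian_ring :: "('a, 'z) ring_scheme \<Rightarrow> bool" where
  "artinian_ring R \<longleftrightarrow> cring R \<and>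
     (\<forall>I :: nat \<Rightarrow> 'a set. (\<forall>n. ideal (I n) R \<and> I (Suc n) \<subseteq> I n) \<longrightarrow>
        (\<exists>N. \<forall>n\<ge>N. I n = I N))"

text \<open>
  The \<open>smult\<close> field of \<open>\<Lambda>\<close> is the action of the commutative base ring \<open>R\<close>;
  the last two equations say that \<open>R\<close> acts through the centre of \<open>\<Lambda>\<close>.
\<close>

definition artin_algebra :: "('r, 'z) ring_scheme \<Rightarrow> ('r, 'a) module \<Rightarrow> bool" where
  "artin_algebra R \<Lambda> \<longleftrightarrow>
     artinian_ring R \<and> ring \<Lambda> \<and> module R \<Lambda> \<and> finitely_generated R \<Lambda> \<and>
     (\<forall>r\<in>carrier R. \<forall>x\<in>carrier \<Lambda>. \<forall>y\<in>carrier \<Lambda>.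
        (r \<odot>\<^bsub>\<Lambda>\<^esub> x) \<otimes>\<^bsub>\<Lambda>\<^esub> y = r \<odot>\<^bsub>\<Lambda>\<^esub> (x \<otimes>\<^bsub>\<Lambda>\<^esub> y) \<and>
        x \<otimes>\<^bsub>\<Lambda>\<^esub> (r \<odot>\<^bsub>\<Lambda>\<^esub> y) = r \<odot>\<^bsub>\<Lambda>\<^esub> (x \<otimes>\<^bsub>\<Lambda>\<^esub> y))"

definition fg_module :: "('a, 'z) ring_scheme \<Rightarrow> ('a, 'b) module \<Rightarrow> bool" where
  "fg_module \<Lambda> M \<longleftrightarrow> right_module \<Lambda> M \<and> finitely_generated \<Lambda> M"

text \<open>
  Homomorphisms are extensional, so that equality of functions is equality of morphisms;
  they are composed with \<open>compose\<close>.
\<close>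

definition mod_hom ::
    "('a, 'z) ring_scheme \<Rightarrow> ('a, 'b) module \<Rightarrow> ('a, 'c) module \<Rightarrow> ('b \<Rightarrow> 'c) set" where
  "mod_hom \<Lambda> M N = {h \<in> carrier M \<rightarrow>\<^sub>E carrier N.
     (\<forall>x\<in>carrier M. \<forall>y\<in>carrier M. h (x \<oplus>\<^bsub>M\<^esub> y) = h x \<oplus>\<^bsub>N\<^esub> h y) \<and>
     (\<forall>a\<in>carrier \<Lambda>. \<forall>x\<in>carrier M. h (a \<odot>\<^bsub>M\<^esub> x) = a \<odot>\<^bsub>N\<^esub> h x)}"

definition mod_id :: "('a, 'b) module \<Rightarrow> 'b \<Rightarrow> 'b" where
  "mod_id M = (\<lambda>x\<in>carrier M. x)"

definition zero_map :: "('a, 'b) module \<Rightarrow> ('a, 'c) module \<Rightarrow> 'b \<Rightarrow> 'c" where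
  "zero_map M N = (\<lambda>x\<in>carrier M. \<zero>\<^bsub>N\<^esub>)"

definition zero_module :: "('a, unit) module" where
  "zero_module = \<lparr>carrier = {()}, mult = (\<lambda>_ _. ()), one = (), zero = (),
                  add = (\<lambda>_ _. ()), smult = (\<lambda>_ _. ())\<rparr>"

definition indecomposable :: "('a, 'z) ring_scheme \<Rightarrow> ('a, 'b) module \<Rightarrow> bool" where
  "indecomposable \<Lambda> M \<longleftrightarrow> carrier M \<noteq> {\<zero>\<^bsub>M\<^esub>} \<and>
     (\<forall>U V. submodule U \<Lambda> M \<and> submodule V \<Lambda> M \<and>
            U <+>\<^bsub>M\<^esub> V = carrier M \<and> U \<inter> V = {\<zero>\<^bsub>M\<^esub>} \<longrightarrow>
            U = {\<zero>\<^bsub>M\<^esub>} \<or> V = {\<zero>\<^bsub>M\<^esub>})"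

text \<open>
  A formula cannot quantify over modules of all types.  A module generated by \<open>n\<close> elements is
  a quotient of \<open>\<Lambda>\<^sup>n\<close>, so every finitely generated module over a ring with elements of type
  \<open>'a\<close> is isomorphic to one whose elements are sets of coefficient sequences (lemma
  \<open>fg_module_universe\<close> below).  A condition on all finitely generated modules that is invariant
  under isomorphism therefore only has to quantify over the following type; the lemmas
  \<open>projective_lift\<close> and \<open>right_approximation_factor\<close> confirm this for the two
  definitions concerned.
\<close>

type_synonym 'a univ_module = "('a, (nat \<Rightarrow> 'a) set) module"

definition projective :: "('a, 'z) ring_scheme \<Rightarrow> ('a, 'b) module \<Rightarrow> bool" where
  "projective \<Lambda> P \<longleftrightarrow> fg_module \<Lambda> P \<and>
     (\<forall>(N :: 'a univ_module) (L :: 'a univ_module). \<forall>g\<in>mod_hom \<Lambda> N L. \<forall>h\<in>mod_hom \<Lambda> P L.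
        fg_module \<Lambda> N \<and> fg_module \<Lambda> L \<and> g ` carrier N = carrier L \<longrightarrow>
        (\<exists>k\<in>mod_hom \<Lambda> P N. compose (carrier P) g k = h))"

definition superfluous :: "('a, 'z) ring_scheme \<Rightarrow> 'b set \<Rightarrow> ('a, 'b) module \<Rightarrow> bool" where
  "superfluous \<Lambda> K P \<longleftrightarrow> submodule K \<Lambda> P \<and>
     (\<forall>U. submodule U \<Lambda> P \<and> K <+>\<^bsub>P\<^esub> U = carrier P \<longrightarrow> U = carrier P)"

definition projective_cover ::
    "('a, 'z) ring_scheme \<Rightarrow> ('a, 'b) module \<Rightarrow> ('b \<Rightarrow> 'c) \<Rightarrow> ('a, 'c) module \<Rightarrow> bool" where
  "projective_cover \<Lambda> P h N \<longleftrightarrow> projective \<Lambda> P \<and> h \<in> mod_hom \<Lambda> P N \<and>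
     h ` carrier P = carrier N \<and> superfluous \<Lambda> (a_kernel P N h) P"

definition minimal_projective_presentation ::
    "('a, 'z) ring_scheme \<Rightarrow> ('a, 'b) module \<Rightarrow> ('b \<Rightarrow> 'c) \<Rightarrow> ('a, 'c) module \<Rightarrow> ('c \<Rightarrow> 'd) \<Rightarrow>
     ('a, 'd) module \<Rightarrow> bool" where
  "minimal_projective_presentation \<Lambda> P\<^sub>1 f P\<^sub>0 \<sigma> M \<longleftrightarrow>
     projective_cover \<Lambda> P\<^sub>0 \<sigma> M \<and>
     projective_cover \<Lambda> P\<^sub>1 f (P\<^sub>0\<lparr>carrier := a_kernel P\<^sub>0 M \<sigma>\<rparr>)"


section \<open>The morphism category\<close>

datatype ('a, 'b, 'c) mor =
  Mor (src: "('a, 'b) module") (tgt: "('a, 'c) module") (arr: "'b \<Rightarrow> 'c")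

definition H_obj :: "('a, 'z) ring_scheme \<Rightarrow> ('a, 'b, 'c) mor \<Rightarrow> bool" where
  "H_obj \<Lambda> X \<longleftrightarrow> fg_module \<Lambda> (src X) \<and> fg_module \<Lambda> (tgt X) \<and>
     arr X \<in> mod_hom \<Lambda> (src X) (tgt X)"

definition H_hom ::
    "('a, 'z) ring_scheme \<Rightarrow> ('a, 'b, 'c) mor \<Rightarrow> ('a, 'd, 'e) mor \<Rightarrow> (('b \<Rightarrow> 'd) \<times> ('c \<Rightarrow> 'e)) set"
  where
  "H_hom \<Lambda> X Y = {(s\<^sub>1, s\<^sub>2).
     s\<^sub>1 \<in> mod_hom \<Lambda> (src X) (src Y) \<and> s\<^sub>2 \<in> mod_hom \<Lambda> (tgt X) (tgt Y) \<and>
     compose (carrier (src X)) s\<^sub>2 (arr X) = compose (carrier (src X)) (arr Y) s\<^sub>1}"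

text \<open>In \<open>H_comp X \<psi> \<phi>\<close>, the object \<open>X\<close> is the source of \<open>\<phi>\<close>.\<close>

definition H_comp ::
    "('a, 'b, 'c) mor \<Rightarrow> ('d \<Rightarrow> 'f) \<times> ('e \<Rightarrow> 'g) \<Rightarrow> ('b \<Rightarrow> 'd) \<times> ('c \<Rightarrow> 'e) \<Rightarrow>
     ('b \<Rightarrow> 'f) \<times> ('c \<Rightarrow> 'g)" where
  "H_comp X \<psi> \<phi> = (compose (carrier (src X)) (fst \<psi>) (fst \<phi>),
                   compose (carrier (tgt X)) (snd \<psi>) (snd \<phi>))"

definition H_id :: "('a, 'b, 'c) mor \<Rightarrow> ('b \<Rightarrow> 'b) \<times> ('c \<Rightarrow> 'c)" where
  "H_id X = (mod_id (src X), mod_id (tgt X))"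

definition H_automorphism ::
    "('a, 'z) ring_scheme \<Rightarrow> ('a, 'b, 'c) mor \<Rightarrow> ('b \<Rightarrow> 'b) \<times> ('c \<Rightarrow> 'c) \<Rightarrow> bool" where
  "H_automorphism \<Lambda> X \<gamma> \<longleftrightarrow> \<gamma> \<in> H_hom \<Lambda> X X \<and>
     (\<exists>\<delta>\<in>H_hom \<Lambda> X X. H_comp X \<delta> \<gamma> = H_id X \<and> H_comp X \<gamma> \<delta> = H_id X)"

definition P_obj :: "('a, 'z) ring_scheme \<Rightarrow> ('a, 'b, 'c) mor \<Rightarrow> bool" where
  "P_obj \<Lambda> X \<longleftrightarrow> H_obj \<Lambda> X \<and> projective \<Lambda> (src X) \<and> projective \<Lambda> (tgt X)"

definition right_P_approximation ::
    "('a, 'z) ring_scheme \<Rightarrow> ('a, 'b, 'c) mor \<Rightarrow> ('a, 'd, 'e) mor \<Rightarrow>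
     ('b \<Rightarrow> 'd) \<times> ('c \<Rightarrow> 'e) \<Rightarrow> bool" where
  "right_P_approximation \<Lambda> P X \<theta> \<longleftrightarrow>
     P_obj \<Lambda> P \<and> H_obj \<Lambda> X \<and> \<theta> \<in> H_hom \<Lambda> P X \<and>
     (\<forall>Q :: ('a, (nat \<Rightarrow> 'a) set, (nat \<Rightarrow> 'a) set) mor. P_obj \<Lambda> Q \<longrightarrow>
        (\<forall>\<phi>\<in>H_hom \<Lambda> Q X. \<exists>\<psi>\<in>H_hom \<Lambda> Q P. \<phi> = H_comp Q \<theta> \<psi>))"

definition right_minimal ::
    "('a, 'z) ring_scheme \<Rightarrow> ('a, 'b, 'c) mor \<Rightarrow> ('b \<Rightarrow> 'd) \<times> ('c \<Rightarrow> 'e) \<Rightarrow> bool" where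
  "right_minimal \<Lambda> P \<theta> \<longleftrightarrow>
     (\<forall>\<gamma>\<in>H_hom \<Lambda> P P. H_comp P \<theta> \<gamma> = \<theta> \<longrightarrow> H_automorphism \<Lambda> P \<gamma>)"

definition right_minimal_P_approximation ::
    "('a, 'z) ring_scheme \<Rightarrow> ('a, 'b, 'c) mor \<Rightarrow> ('a, 'd, 'e) mor \<Rightarrow>
     ('b \<Rightarrow> 'd) \<times> ('c \<Rightarrow> 'e) \<Rightarrow> bool" where
  "right_minimal_P_approximation \<Lambda> P X \<theta> \<longleftrightarrow>
     right_P_approximation \<Lambda> P X \<theta> \<and> right_minimal \<Lambda> P \<theta>"


section \<open>Independence of the type of the modules\<close>

lemma mod_hom_closed: "h \<in> mod_hom \<Lambda> M N \<Longrightarrow> x \<in> carrier M \<Longrightarrow> h x \<in> carrier N"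
  by (auto simp: mod_hom_def)

lemma mod_hom_compose:
  assumes "right_module \<Lambda> M" "g \<in> mod_hom \<Lambda> N L" "h \<in> mod_hom \<Lambda> M N"
  shows "compose (carrier M) g h \<in> mod_hom \<Lambda> M L"
proof -
  interpret right_module \<Lambda> M by fact
  show ?thesis using assms(2,3)
    by (auto simp: mod_hom_def compose_def PiE_iff)
qed

lemma mod_hom_ext:
  assumes "g \<in> mod_hom \<Lambda> M N" "h \<in> mod_hom \<Lambda> M N" "\<And>x. x \<in> carrier M \<Longrightarrow> g x = h x"
  shows "g = h"
proof
  fix x
  show "g x = h x"
    using assms by (cases "x \<in> carrier M") (auto simp: mod_hom_def PiE_iff extensional_def)
qed

lemma mod_hom_zero:
  assumes "right_module \<Lambda> M" "right_module \<Lambda> N" "h \<in> mod_hom \<Lambda> M N"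
  shows "h \<zero>\<^bsub>M\<^esub> = \<zero>\<^bsub>N\<^esub>"
proof -
  interpret M: right_module \<Lambda> M by fact
  interpret N: right_module \<Lambda> N by fact
  have z: "\<zero>\<^bsub>M\<^esub> \<in> carrier M" by simp
  have "h \<zero>\<^bsub>M\<^esub> \<in> carrier N" using mod_hom_closed[OF assms(3) z] .
  moreover have "h (\<zero>\<^bsub>M\<^esub> \<oplus>\<^bsub>M\<^esub> \<zero>\<^bsub>M\<^esub>) = h \<zero>\<^bsub>M\<^esub> \<oplus>\<^bsub>N\<^esub> h \<zero>\<^bsub>M\<^esub>"
    using assms(3) z unfolding mod_hom_def by blast
  ultimately show ?thesis by (metis N.M.add.l_cancel_one' M.M.l_zero z)
qed

lemma mod_hom_finsum:
  assumes "right_module \<Lambda> M" "right_module \<Lambda> N" "h \<in> mod_hom \<Lambda> M N"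
    and "finite A" "u \<in> A \<rightarrow> carrier M"
  shows "h (\<Oplus>\<^bsub>M\<^esub>a\<in>A. u a) = (\<Oplus>\<^bsub>N\<^esub>a\<in>A. h (u a))"
proof -
  interpret M: right_module \<Lambda> M by fact
  interpret N: right_module \<Lambda> N by fact
  show ?thesis using assms(4,5)
  proof (induction A)
    case empty
    then show ?case using mod_hom_zero[OF assms(1-3)] by simp
  next
    case (insert a A)
    then have u: "u a \<in> carrier M" "u \<in> A \<rightarrow> carrier M" by auto
    then have hu: "h (u a) \<in> carrier N" "(\<lambda>a. h (u a)) \<in> A \<rightarrow> carrier N"
      using mod_hom_closed[OF assms(3)] by auto
    have "(\<Oplus>\<^bsub>M\<^esub>a\<in>A. u a) \<in> carrier M" using u by simp
    then have "h (u a \<oplus>\<^bsub>M\<^esub> (\<Oplus>\<^bsub>M\<^esub>a\<in>A. u a)) = h (u a) \<oplus>\<^bsub>N\<^esub> h (\<Oplus>\<^bsub>M\<^esub>a\<in>A. u a)"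
      using assms(3) u unfolding mod_hom_def by blast
    then show ?case using insert u hu by simp
  qed
qed

lemma fg_module_transport:
  fixes N :: "('a, 'b) module" and j :: "'b \<Rightarrow> 'c"
  assumes N: "fg_module \<Lambda> N" and j: "inj_on j (carrier N)"
  obtains N' :: "('a, 'c) module" and i k where
    "fg_module \<Lambda> N'" "i \<in> mod_hom \<Lambda> N N'" "k \<in> mod_hom \<Lambda> N' N"
    "\<And>x. x \<in> carrier N \<Longrightarrow> k (i x) = x" "\<And>y. y \<in> carrier N' \<Longrightarrow> i (k y) = y"
proof -
  have rm: "right_module \<Lambda> N" using N by (simp add: fg_module_def)
  interpret N: right_module \<Lambda> N by fact
  define q where "q = the_inv_into (carrier N) j"
  have qj [simp]: "q (j x) = x" if "x \<in> carrier N" for x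
    using that j by (simp add: q_def the_inv_into_f_f)
  define N' :: "('a, 'c) module" where
    "N' = \<lparr>carrier = j ` carrier N, mult = (\<lambda>_ _. undefined), one = undefined, zero = j \<zero>\<^bsub>N\<^esub>,
           add = (\<lambda>x y. j (q x \<oplus>\<^bsub>N\<^esub> q y)), smult = (\<lambda>a x. j (a \<odot>\<^bsub>N\<^esub> q x))\<rparr>"
  have car: "carrier N' = j ` carrier N" and zer: "\<zero>\<^bsub>N'\<^esub> = j \<zero>\<^bsub>N\<^esub>"
    and add: "\<And>x y. x \<oplus>\<^bsub>N'\<^esub> y = j (q x \<oplus>\<^bsub>N\<^esub> q y)"
    and smu: "\<And>a x. a \<odot>\<^bsub>N'\<^esub> x = j (a \<odot>\<^bsub>N\<^esub> q x)"
    by (simp_all add: N'_def)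
  have ag: "abelian_group N'"
  proof (rule abelian_groupI)
    fix x assume "x \<in> carrier N'"
    then obtain y where y: "y \<in> carrier N" "x = j y" by (auto simp: car)
    show "\<exists>z\<in>carrier N'. z \<oplus>\<^bsub>N'\<^esub> x = \<zero>\<^bsub>N'\<^esub>"
      using y by (intro bexI[of _ "j (\<ominus>\<^bsub>N\<^esub> y)"]) (auto simp: car zer add N.M.l_neg)
  qed (auto simp: car zer add N.M.a_ac)
  have rm': "right_module \<Lambda> N'"
    by (intro right_module.intro right_module_axioms.intro N.R.ring_axioms ag)
       (auto simp: car add smu N.smult_l_distr N.smult_r_distr N.smult_assoc_right)
  interpret N': right_module \<Lambda> N' by fact
  define i where "i = (\<lambda>x\<in>carrier N. j x)"
  define k where "k = (\<lambda>y\<in>carrier N'. q y)"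
  have i: "i \<in> mod_hom \<Lambda> N N'" and k: "k \<in> mod_hom \<Lambda> N' N"
    by (auto simp: mod_hom_def i_def k_def car add smu)
  have ki: "k (i x) = x" if "x \<in> carrier N" for x using that by (simp add: i_def k_def car)
  have ik: "i (k y) = y" if "y \<in> carrier N'" for y using that by (auto simp: i_def k_def car)
  obtain S where S: "finite S" "S \<subseteq> carrier N"
    "\<And>x. x \<in> carrier N \<Longrightarrow> \<exists>c\<in>S \<rightarrow> carrier \<Lambda>. x = (\<Oplus>\<^bsub>N\<^esub>s\<in>S. c s \<odot>\<^bsub>N\<^esub> s)"
    using N unfolding fg_module_def finitely_generated_def by blast
  have "\<exists>c\<in>i ` S \<rightarrow> carrier \<Lambda>. y = (\<Oplus>\<^bsub>N'\<^esub>s\<in>i ` S. c s \<odot>\<^bsub>N'\<^esub> s)" if y: "y \<in> carrier N'" for y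
  proof -
    have "k y \<in> carrier N" using mod_hom_closed[OF k y] .
    then obtain c where c: "c \<in> S \<rightarrow> carrier \<Lambda>" "k y = (\<Oplus>\<^bsub>N\<^esub>s\<in>S. c s \<odot>\<^bsub>N\<^esub> s)" using S(3) by blast
    have iS: "i s \<in> carrier N'" if "s \<in> S" for s using that S(2) mod_hom_closed[OF i] by blast
    have "y = i (\<Oplus>\<^bsub>N\<^esub>s\<in>S. c s \<odot>\<^bsub>N\<^esub> s)" using ik[OF y] c(2) by simp
    also have "\<dots> = (\<Oplus>\<^bsub>N'\<^esub>s\<in>S. i (c s \<odot>\<^bsub>N\<^esub> s))"
      using c(1) S(2) by (intro mod_hom_finsum[OF rm rm' i S(1)]) auto
    also have "\<dots> = (\<Oplus>\<^bsub>N'\<^esub>s\<in>S. c (k (i s)) \<odot>\<^bsub>N'\<^esub> i s)"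
    proof (rule N'.M.finsum_cong')
      show "(\<lambda>s. c (k (i s)) \<odot>\<^bsub>N'\<^esub> i s) \<in> S \<rightarrow> carrier N'"
        using c(1) S(2) iS ki by (auto simp: subset_iff Pi_iff)
      show "i (c s \<odot>\<^bsub>N\<^esub> s) = c (k (i s)) \<odot>\<^bsub>N'\<^esub> i s" if "s \<in> S" for s
        using that c(1) S(2) i ki by (auto simp: mod_hom_def Pi_iff subset_iff)
    qed simp
    also have "\<dots> = (\<Oplus>\<^bsub>N'\<^esub>t\<in>i ` S. c (k t) \<odot>\<^bsub>N'\<^esub> t)"
    proof (rule N'.M.finsum_reindex[symmetric])
      show "(\<lambda>t. c (k t) \<odot>\<^bsub>N'\<^esub> t) \<in> i ` S \<rightarrow> carrier N'"
        using c(1) S(2) iS ki by (auto simp: subset_iff Pi_iff)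
      show "inj_on i S" using S(2) ki by (metis inj_onI subsetD)
    qed
    finally show ?thesis using c(1) S(2) ki
      by (intro bexI[of _ "\<lambda>t. c (k t)"]) (auto simp: Pi_iff subset_iff)
  qed
  moreover have "finite (i ` S)" "i ` S \<subseteq> carrier N'"
    using S mod_hom_closed[OF i] by auto
  ultimately have "fg_module \<Lambda> N'"
    unfolding fg_module_def finitely_generated_def using rm' by blast
  then show ?thesis using that i k ki ik by blast
qed

lemma fg_module_universe:
  fixes N :: "('a, 'b) module"
  assumes N: "fg_module \<Lambda> N"
  obtains N' :: "'a univ_module" and i k where
    "fg_module \<Lambda> N'" "i \<in> mod_hom \<Lambda> N N'" "k \<in> mod_hom \<Lambda> N' N"
    "\<And>x. x \<in> carrier N \<Longrightarrow> k (i x) = x" "\<And>y. y \<in> carrier N' \<Longrightarrow> i (k y) = y"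
proof -
  interpret N: right_module \<Lambda> N using N by (simp add: fg_module_def)
  obtain S where S: "finite S" "S \<subseteq> carrier N"
    "\<And>x. x \<in> carrier N \<Longrightarrow> \<exists>c\<in>S \<rightarrow> carrier \<Lambda>. x = (\<Oplus>\<^bsub>N\<^esub>s\<in>S. c s \<odot>\<^bsub>N\<^esub> s)"
    using N unfolding fg_module_def finitely_generated_def by blast
  obtain e :: "'b \<Rightarrow> nat" where e: "inj_on e S"
    using finite_imp_inj_to_nat_seg[OF S(1)] by blast
  define j where "j x = {d :: nat \<Rightarrow> 'a. d \<in> e ` S \<rightarrow> carrier \<Lambda> \<and>
      x = (\<Oplus>\<^bsub>N\<^esub>s\<in>S. d (e s) \<odot>\<^bsub>N\<^esub> s)}" for x
  have ne: "j x \<noteq> {}" if x: "x \<in> carrier N" for x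
  proof -
    obtain c where c: "c \<in> S \<rightarrow> carrier \<Lambda>" "x = (\<Oplus>\<^bsub>N\<^esub>s\<in>S. c s \<odot>\<^bsub>N\<^esub> s)" using S(3)[OF x] by blast
    have "(\<Oplus>\<^bsub>N\<^esub>s\<in>S. c (the_inv_into S e (e s)) \<odot>\<^bsub>N\<^esub> s) = (\<Oplus>\<^bsub>N\<^esub>s\<in>S. c s \<odot>\<^bsub>N\<^esub> s)"
      using c(1) S(2) e by (intro N.M.finsum_cong') (auto simp: the_inv_into_f_f)
    then have "(\<lambda>n. c (the_inv_into S e n)) \<in> j x"
      using c e by (auto simp: j_def the_inv_into_f_f)
    then show ?thesis by blast
  qed
  have "inj_on j (carrier N)"
  proof (rule inj_onI)
    fix x y assume "x \<in> carrier N" "y \<in> carrier N" "j x = j y"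
    then obtain d where "d \<in> j x" "d \<in> j y" using ne by blast
    then show "x = y" by (simp add: j_def)
  qed
  then show ?thesis using fg_module_transport[OF N] that by blast
qed

lemma projective_lift:
  fixes N :: "('a, 'c) module" and L :: "('a, 'd) module"
  assumes P: "projective \<Lambda> P" and N: "fg_module \<Lambda> N" and L: "fg_module \<Lambda> L"
    and g: "g \<in> mod_hom \<Lambda> N L" "g ` carrier N = carrier L" and h: "h \<in> mod_hom \<Lambda> P L"
  obtains k where "k \<in> mod_hom \<Lambda> P N" "compose (carrier P) g k = h"
proof -
  obtain N' :: "'a univ_module" and i1 k1 where N': "fg_module \<Lambda> N'" "i1 \<in> mod_hom \<Lambda> N N'"
    "k1 \<in> mod_hom \<Lambda> N' N" "\<And>x. x \<in> carrier N \<Longrightarrow> k1 (i1 x) = x"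
    "\<And>y. y \<in> carrier N' \<Longrightarrow> i1 (k1 y) = y"
    using fg_module_universe[OF N] by metis
  obtain L' :: "'a univ_module" and i2 k2 where L': "fg_module \<Lambda> L'" "i2 \<in> mod_hom \<Lambda> L L'"
    "k2 \<in> mod_hom \<Lambda> L' L" "\<And>x. x \<in> carrier L \<Longrightarrow> k2 (i2 x) = x"
    "\<And>y. y \<in> carrier L' \<Longrightarrow> i2 (k2 y) = y"
    using fg_module_universe[OF L] by metis
  have rm: "right_module \<Lambda> P" "right_module \<Lambda> N'" "right_module \<Lambda> N"
    using P N N' by (auto simp: projective_def fg_module_def)
  define g' where "g' = compose (carrier N') i2 (compose (carrier N') g k1)"
  define h' where "h' = compose (carrier P) i2 h"
  have g': "g' \<in> mod_hom \<Lambda> N' L'"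
    unfolding g'_def by (rule mod_hom_compose[OF rm(2) L'(2) mod_hom_compose[OF rm(2) g(1) N'(3)]])
  have h': "h' \<in> mod_hom \<Lambda> P L'"
    unfolding h'_def by (rule mod_hom_compose[OF rm(1) L'(2) h])
  have "g' ` carrier N' = carrier L'"
  proof (intro equalityI subsetI)
    fix y assume y: "y \<in> carrier L'"
    then have "k2 y \<in> carrier L" using mod_hom_closed[OF L'(3)] by blast
    then obtain x where x: "x \<in> carrier N" "k2 y = g x" using g(2) by blast
    have ix: "i1 x \<in> carrier N'" using mod_hom_closed[OF N'(2) x(1)] .
    have "g' (i1 x) = y" using x y ix N'(4) L'(5) by (simp add: g'_def compose_def) metis
    then show "y \<in> g' ` carrier N'" using ix by blast
  qed (use mod_hom_closed[OF g'] in blast)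
  then obtain k' where k': "k' \<in> mod_hom \<Lambda> P N'" "compose (carrier P) g' k' = h'"
    using P g' h' N'(1) L'(1) unfolding projective_def by blast
  have k: "compose (carrier P) k1 k' \<in> mod_hom \<Lambda> P N"
    by (rule mod_hom_compose[OF rm(1) N'(3) k'(1)])
  have "compose (carrier P) g (compose (carrier P) k1 k') = h"
  proof (rule mod_hom_ext[OF mod_hom_compose[OF rm(1) g(1) k] h])
    fix x assume x: "x \<in> carrier P"
    have c: "k' x \<in> carrier N'" "h x \<in> carrier L" "g (k1 (k' x)) \<in> carrier L"
      using x k'(1) h g(1) N'(3) by (meson mod_hom_closed)+
    have "i2 (g (k1 (k' x))) = i2 (h x)"
      using fun_cong[OF k'(2), of x] x c by (simp add: g'_def h'_def compose_def)
    then have "g (k1 (k' x)) = h x" using L'(4) c by metis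
    then show "compose (carrier P) g (compose (carrier P) k1 k') x = h x"
      using x by (simp add: compose_def)
  qed
  then show ?thesis using that k by blast
qed

lemma projective_transport:
  fixes P :: "('a, 'b) module" and P' :: "('a, 'c) module"
  assumes P: "projective \<Lambda> P" and P': "fg_module \<Lambda> P'"
    and i: "i \<in> mod_hom \<Lambda> P P'" and k: "k \<in> mod_hom \<Lambda> P' P"
    and ik: "\<And>y. y \<in> carrier P' \<Longrightarrow> i (k y) = y"
  shows "projective \<Lambda> P'"
  unfolding projective_def
proof (intro conjI P' allI ballI impI)
  have rm: "right_module \<Lambda> P" "right_module \<Lambda> P'"
    using P P' by (auto simp: projective_def fg_module_def)
  fix N L :: "'a univ_module" and g h
  assume g: "g \<in> mod_hom \<Lambda> N L" and h: "h \<in> mod_hom \<Lambda> P' L"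
    and NL: "fg_module \<Lambda> N \<and> fg_module \<Lambda> L \<and> g ` carrier N = carrier L"
  obtain u where u: "u \<in> mod_hom \<Lambda> P N" "compose (carrier P) g u = compose (carrier P) h i"
    using projective_lift[OF P _ _ g _ mod_hom_compose[OF rm(1) h i]] NL by metis
  have uk: "compose (carrier P') u k \<in> mod_hom \<Lambda> P' N"
    by (rule mod_hom_compose[OF rm(2) u(1) k])
  have "compose (carrier P') g (compose (carrier P') u k) = h"
  proof (rule mod_hom_ext[OF mod_hom_compose[OF rm(2) g uk] h])
    fix x assume x: "x \<in> carrier P'"
    then have "k x \<in> carrier P" using mod_hom_closed[OF k] by blast
    then show "compose (carrier P') g (compose (carrier P') u k) x = h x"
      using fun_cong[OF u(2), of "k x"] x ik by (simp add: compose_def)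
  qed
  then show "\<exists>w\<in>mod_hom \<Lambda> P' N. compose (carrier P') g w = h" using uk by blast
qed

lemma right_approximation_factor:
  fixes Q :: "('a, 'f, 'g) mor"
  assumes ap: "right_P_approximation \<Lambda> P X \<theta>" and Q: "P_obj \<Lambda> Q" and \<phi>: "\<phi> \<in> H_hom \<Lambda> Q X"
  obtains \<psi> where "\<psi> \<in> H_hom \<Lambda> Q P" "\<phi> = H_comp Q \<theta> \<psi>"
proof -
  have fg: "fg_module \<Lambda> (src Q)" "fg_module \<Lambda> (tgt Q)" and arrQ: "arr Q \<in> mod_hom \<Lambda> (src Q) (tgt Q)"
    and pr: "projective \<Lambda> (src Q)" "projective \<Lambda> (tgt Q)"
    using Q by (auto simp: P_obj_def H_obj_def)
  obtain A :: "'a univ_module" and i1 k1 where A: "fg_module \<Lambda> A" "i1 \<in> mod_hom \<Lambda> (src Q) A"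
    "k1 \<in> mod_hom \<Lambda> A (src Q)" "\<And>x. x \<in> carrier (src Q) \<Longrightarrow> k1 (i1 x) = x"
    "\<And>y. y \<in> carrier A \<Longrightarrow> i1 (k1 y) = y"
    using fg_module_universe[OF fg(1)] by metis
  obtain B :: "'a univ_module" and i2 k2 where B: "fg_module \<Lambda> B" "i2 \<in> mod_hom \<Lambda> (tgt Q) B"
    "k2 \<in> mod_hom \<Lambda> B (tgt Q)" "\<And>x. x \<in> carrier (tgt Q) \<Longrightarrow> k2 (i2 x) = x"
    "\<And>y. y \<in> carrier B \<Longrightarrow> i2 (k2 y) = y"
    using fg_module_universe[OF fg(2)] by metis
  have rm: "right_module \<Lambda> (src Q)" "right_module \<Lambda> (tgt Q)" "right_module \<Lambda> A" "right_module \<Lambda> B"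
    using fg A B by (auto simp: fg_module_def)
  define a where "a = compose (carrier A) i2 (compose (carrier A) (arr Q) k1)"
  have a: "a \<in> mod_hom \<Lambda> A B"
    unfolding a_def by (rule mod_hom_compose[OF rm(3) B(2) mod_hom_compose[OF rm(3) arrQ A(3)]])
  define Q' where "Q' = Mor A B a"
  have Q': "P_obj \<Lambda> Q'"
    using A(1) B(1) a projective_transport[OF pr(1) A(1,2,3,5)] projective_transport[OF pr(2) B(1,2,3,5)]
    by (simp add: P_obj_def H_obj_def Q'_def)
  obtain p q where pq: "\<phi> = (p, q)" by fastforce
  have p: "p \<in> mod_hom \<Lambda> (src Q) (src X)" and q: "q \<in> mod_hom \<Lambda> (tgt Q) (tgt X)"
    and sq: "compose (carrier (src Q)) q (arr Q) = compose (carrier (src Q)) (arr X) p"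
    using \<phi> by (auto simp: H_hom_def pq)
  have sq': "q (arr Q x) = arr X (p x)" if "x \<in> carrier (src Q)" for x
    using fun_cong[OF sq, of x] that by (simp add: compose_def)
  have "(compose (carrier A) p k1, compose (carrier B) q k2) \<in> H_hom \<Lambda> Q' X"
  proof -
    have "compose (carrier A) (compose (carrier B) q k2) a =
          compose (carrier A) (arr X) (compose (carrier A) p k1)"
    proof
      fix x
      show "compose (carrier A) (compose (carrier B) q k2) a x =
          compose (carrier A) (arr X) (compose (carrier A) p k1) x"
      proof (cases "x \<in> carrier A")
        case True
        then have c: "k1 x \<in> carrier (src Q)" "a x \<in> carrier B" "arr Q (k1 x) \<in> carrier (tgt Q)"
          using mod_hom_closed[OF A(3)] mod_hom_closed[OF a] mod_hom_closed[OF arrQ] by auto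
        have "k2 (a x) = arr Q (k1 x)" using True B(4)[OF c(3)] by (simp add: a_def compose_def)
        then show ?thesis using True c sq' by (simp add: compose_def)
      qed (simp add: compose_def)
    qed
    then show ?thesis using mod_hom_compose[OF rm(3) p A(3)] mod_hom_compose[OF rm(4) q B(3)]
      by (simp add: H_hom_def Q'_def)
  qed
  then obtain \<psi>' where \<psi>': "\<psi>' \<in> H_hom \<Lambda> Q' P"
    "(compose (carrier A) p k1, compose (carrier B) q k2) = H_comp Q' \<theta> \<psi>'"
    using ap Q' unfolding right_P_approximation_def by blast
  obtain u v where uv: "\<psi>' = (u, v)" by fastforce
  have u: "u \<in> mod_hom \<Lambda> A (src P)" and v: "v \<in> mod_hom \<Lambda> B (tgt P)"
    and squ: "compose (carrier A) v a = compose (carrier A) (arr P) u"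
    using \<psi>'(1) by (auto simp: H_hom_def uv Q'_def)
  have e1: "compose (carrier A) p k1 = compose (carrier A) (fst \<theta>) u"
    and e2: "compose (carrier B) q k2 = compose (carrier B) (snd \<theta>) v"
    using \<psi>'(2) by (auto simp: H_comp_def uv Q'_def)
  define U where "U = compose (carrier (src Q)) u i1"
  define V where "V = compose (carrier (tgt Q)) v i2"
  have i1c: "i1 x \<in> carrier A" if "x \<in> carrier (src Q)" for x using mod_hom_closed[OF A(2) that] .
  have i2c: "i2 x \<in> carrier B" if "x \<in> carrier (tgt Q)" for x using mod_hom_closed[OF B(2) that] .
  have arc: "arr Q x \<in> carrier (tgt Q)" if "x \<in> carrier (src Q)" for x
    using mod_hom_closed[OF arrQ that] .
  have "(U, V) \<in> H_hom \<Lambda> Q P"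
  proof -
    have "compose (carrier (src Q)) V (arr Q) x = compose (carrier (src Q)) (arr P) U x" for x
    proof (cases "x \<in> carrier (src Q)")
      case True
      have "a (i1 x) = i2 (arr Q x)" using True i1c A(4) by (simp add: a_def compose_def)
      then show ?thesis
        using True i1c arc fun_cong[OF squ, of "i1 x"] by (simp add: compose_def U_def V_def)
    qed (simp add: compose_def)
    then show ?thesis
      using mod_hom_compose[OF rm(1) u A(2)] mod_hom_compose[OF rm(2) v B(2)]
      by (auto simp: H_hom_def U_def V_def)
  qed
  moreover have "\<phi> = H_comp Q \<theta> (U, V)"
  proof -
    have "p x = compose (carrier (src Q)) (fst \<theta>) U x" for x
    proof (cases "x \<in> carrier (src Q)")
      case True
      then show ?thesis using i1c A(4) fun_cong[OF e1, of "i1 x"] by (simp add: compose_def U_def)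
    next
      case False
      then show ?thesis using p by (auto simp: mod_hom_def compose_def PiE_iff extensional_def)
    qed
    moreover have "q x = compose (carrier (tgt Q)) (snd \<theta>) V x" for x
    proof (cases "x \<in> carrier (tgt Q)")
      case True
      then show ?thesis using i2c B(4) fun_cong[OF e2, of "i2 x"] by (simp add: compose_def V_def)
    next
      case False
      then show ?thesis using q by (auto simp: mod_hom_def compose_def PiE_iff extensional_def)
    qed
    ultimately show ?thesis by (auto simp: H_comp_def pq)
  qed
  ultimately show ?thesis using that by blast
qed

end

theory Submission
  imports Defs
begin

text \<open>
  Given the cover \<open>h : P \<rightarrow> N\<close> and \<open>\<gamma> : P \<rightarrow> P\<close> inducing a bijection on \<open>N\<close>, the image of \<open>\<gamma>\<close>
  together with the superfluous kernel of \<open>h\<close> generates \<open>P\<close>, so \<open>\<gamma>\<close> is onto and splits; its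
  section induces the inverse bijection on \<open>N\<close>, hence is onto as well, and \<open>\<gamma>\<close> is an automorphism.
  Applied to \<open>\<sigma>\<close>, and to \<open>f\<close> as a cover of the kernel of \<open>\<sigma>\<close>, this yields all minimality claims;
  the factorizations are lifts along \<open>\<sigma>\<close> and then along \<open>f\<close>.
\<close>

section \<open>Homomorphisms and the zero module\<close>

lemma mod_hom_add:
  "h \<in> mod_hom \<Lambda> M N \<Longrightarrow> x \<in> carrier M \<Longrightarrow> y \<in> carrier M \<Longrightarrow> h (x \<oplus>\<^bsub>M\<^esub> y) = h x \<oplus>\<^bsub>N\<^esub> h y"
  by (simp add: mod_hom_def)

lemma mod_hom_smult:
  "h \<in> mod_hom \<Lambda> M N \<Longrightarrow> a \<in> carrier \<Lambda> \<Longrightarrow> x \<in> carrier M \<Longrightarrow> h (a \<odot>\<^bsub>M\<^esub> x) = a \<odot>\<^bsub>N\<^esub> h x"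
  by (simp add: mod_hom_def)

lemma mod_id_mod_hom: "right_module \<Lambda> M \<Longrightarrow> mod_id M \<in> mod_hom \<Lambda> M M"
proof -
  assume "right_module \<Lambda> M"
  then interpret right_module \<Lambda> M .
  show ?thesis by (auto simp: mod_hom_def mod_id_def)
qed

lemma zero_map_mod_hom:
  assumes "right_module \<Lambda> M" "right_module \<Lambda> N"
  shows "zero_map M N \<in> mod_hom \<Lambda> M N"
proof -
  interpret M: right_module \<Lambda> M by fact
  interpret N: right_module \<Lambda> N by fact
  \<comment> \<open>That scalars kill zero is not among the module axioms; it follows from
    distributivity by cancelling.\<close>
  have "a \<odot>\<^bsub>N\<^esub> \<zero>\<^bsub>N\<^esub> = \<zero>\<^bsub>N\<^esub>" if a: "a \<in> carrier \<Lambda>" for a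
  proof -
    have "a \<odot>\<^bsub>N\<^esub> \<zero>\<^bsub>N\<^esub> \<oplus>\<^bsub>N\<^esub> a \<odot>\<^bsub>N\<^esub> \<zero>\<^bsub>N\<^esub> = a \<odot>\<^bsub>N\<^esub> \<zero>\<^bsub>N\<^esub>"
      using N.smult_r_distr[OF a, of "\<zero>\<^bsub>N\<^esub>" "\<zero>\<^bsub>N\<^esub>"] by simp
    then show ?thesis by (metis N.M.add.l_cancel_one N.M.zero_closed N.smult_closed a)
  qed
  then show ?thesis by (auto simp: mod_hom_def zero_map_def)
qed

lemma right_module_zero_module: "ring \<Lambda> \<Longrightarrow> right_module \<Lambda> zero_module"
  by (intro right_module.intro right_module_axioms.intro abelian_groupI)
    (auto simp: zero_module_def)

lemma fg_module_zero_module: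
  assumes "ring \<Lambda>"
  shows "fg_module \<Lambda> (zero_module :: ('a, unit) module)"
proof -
  interpret right_module \<Lambda> "zero_module :: ('a, unit) module"
    by (rule right_module_zero_module[OF assms])
  show ?thesis unfolding fg_module_def finitely_generated_def
    by (intro conjI exI[of _ "{}"]) (auto simp: right_module_axioms)
qed

text \<open>Needed to have \<open>P\<^sub>0\<close> -> 0 among the projective objects in (3). A
  homomorphism out of the zero module takes only the value zero, so the zero map lifts it.\<close>

lemma projective_zero_module:
  assumes "ring \<Lambda>"
  shows "projective \<Lambda> (zero_module :: ('a, unit) module)"
  unfolding projective_def
proof (intro conjI allI ballI impI)
  show "fg_module \<Lambda> (zero_module :: ('a, unit) module)"
    by (rule fg_module_zero_module[OF assms])
  fix N L :: "'a univ_module" and g h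
  let ?Z = "zero_module :: ('a, unit) module"
  assume g: "g \<in> mod_hom \<Lambda> N L" and h: "h \<in> mod_hom \<Lambda> ?Z L"
    and "fg_module \<Lambda> N \<and> fg_module \<Lambda> L \<and> g ` carrier N = carrier L"
  then have rm: "right_module \<Lambda> N" "right_module \<Lambda> L" "right_module \<Lambda> ?Z"
    using right_module_zero_module[OF assms] by (auto simp: fg_module_def)
  have k: "zero_map ?Z N \<in> mod_hom \<Lambda> ?Z N" by (rule zero_map_mod_hom[OF rm(3,1)])
  have "compose (carrier ?Z) g (zero_map ?Z N) = h"
  proof (rule mod_hom_ext[OF mod_hom_compose[OF rm(3) g k] h])
    fix x assume x: "x \<in> carrier ?Z"
    then have "x = \<zero>\<^bsub>?Z\<^esub>" by (simp add: zero_module_def)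
    then show "compose (carrier ?Z) g (zero_map ?Z N) x = h x"
      using x mod_hom_zero[OF rm(1,2) g] mod_hom_zero[OF rm(3,2) h]
      by (simp add: compose_def zero_map_def)
  qed
  then show "\<exists>k\<in>mod_hom \<Lambda> ?Z N. compose (carrier ?Z) g k = h" using k by blast
qed

section \<open>Submodules and homomorphic images\<close>

text \<open>Applied to the kernel of \<open>\<sigma>\<close>: lifting along \<open>f\<close>
  requires it as a module in its own right, whereas \<open>submodule\<close> only provides a subset
  closed under the operations.\<close>

lemma right_module_submodule:
  assumes "right_module \<Lambda> M" "submodule K \<Lambda> M"
  shows "right_module \<Lambda> (M\<lparr>carrier := K\<rparr>)"
proof -
  interpret M: right_module \<Lambda> M by fact
  interpret K: submodule K \<Lambda> M by fact
  have sub: "x \<in> carrier M" if "x \<in> K" for x using that K.subset by auto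
  have add: "x \<oplus>\<^bsub>M\<^esub> y \<in> K" if "x \<in> K" "y \<in> K" for x y using K.m_closed[OF that] by simp
  have zero: "\<zero>\<^bsub>M\<^esub> \<in> K" using K.one_closed by simp
  have neg: "\<exists>y\<in>K. y \<oplus>\<^bsub>M\<^esub> x = \<zero>\<^bsub>M\<^esub>" if "x \<in> K" for x
    using K.m_inv_closed[OF that] M.M.l_neg[OF sub[OF that]] unfolding a_inv_def by blast
  show ?thesis
  proof (intro right_module.intro right_module_axioms.intro)
    show "abelian_group (M\<lparr>carrier := K\<rparr>)"
      by (rule abelian_groupI) (simp_all add: sub add zero neg M.M.a_assoc, simp add: sub M.M.a_comm)
  qed (simp_all add: sub M.R.ring_axioms K.smult_closed M.smult_l_distr M.smult_r_distr M.smult_assoc_right)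
qed

text \<open>Since \<open>h\<close> may identify elements of \<open>S\<close>, the sum cannot simply
  be reindexed by the image. Coefficients over the same fibre are added up instead, taking in one
  element of \<open>S\<close> at a time.\<close>

lemma finsum_smult_image:
  assumes "right_module \<Lambda> N" "finite S" "h \<in> S \<rightarrow> carrier N" "c \<in> S \<rightarrow> carrier \<Lambda>"
  shows "\<exists>d\<in>h ` S \<rightarrow> carrier \<Lambda>. (\<Oplus>\<^bsub>N\<^esub>s\<in>S. c s \<odot>\<^bsub>N\<^esub> h s) = (\<Oplus>\<^bsub>N\<^esub>t\<in>h ` S. d t \<odot>\<^bsub>N\<^esub> t)"
proof -
  interpret N: right_module \<Lambda> N by fact
  show ?thesis using assms(2-4)
  proof (induction S)
    case empty
    then show ?case by auto
  next
    case (insert a S)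
    then have a: "h a \<in> carrier N" "c a \<in> carrier \<Lambda>"
      and S: "h \<in> S \<rightarrow> carrier N" "c \<in> S \<rightarrow> carrier \<Lambda>" "h ` S \<subseteq> carrier N" by auto
    obtain d where d: "d \<in> h ` S \<rightarrow> carrier \<Lambda>"
      "(\<Oplus>\<^bsub>N\<^esub>s\<in>S. c s \<odot>\<^bsub>N\<^esub> h s) = (\<Oplus>\<^bsub>N\<^esub>t\<in>h ` S. d t \<odot>\<^bsub>N\<^esub> t)"
      using insert.IH S by blast
    \<comment> \<open>\<open>h a\<close> is split off because its coefficient is the only one that
      changes.\<close>
    define T where "T = h ` S - {h a}"
    have T: "finite T" "h a \<notin> T" "T \<subseteq> carrier N" "d \<in> T \<rightarrow> carrier \<Lambda>"
      using insert.hyps S d by (auto simp: T_def)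
    \<comment> \<open>If \<open>h a\<close> already occurs in the image of \<open>S\<close>, the
      coefficient \<open>c a\<close> is added to the old one; otherwise \<open>d (h a)\<close> is an
      arbitrary value and is discarded.\<close>
    define e where "e = d(h a := if h a \<in> h ` S then c a \<oplus>\<^bsub>\<Lambda>\<^esub> d (h a) else c a)"
    have e: "e \<in> h ` insert a S \<rightarrow> carrier \<Lambda>" using d(1) a by (force simp: e_def Pi_iff)
    then have ea: "e (h a) \<in> carrier \<Lambda>" by auto
    have rest: "(\<Oplus>\<^bsub>N\<^esub>t\<in>T. e t \<odot>\<^bsub>N\<^esub> t) = (\<Oplus>\<^bsub>N\<^esub>t\<in>T. d t \<odot>\<^bsub>N\<^esub> t)"
      using T by (intro N.M.finsum_cong') (auto simp: e_def)
    have Tc: "(\<lambda>t. d t \<odot>\<^bsub>N\<^esub> t) \<in> T \<rightarrow> carrier N" "(\<lambda>t. e t \<odot>\<^bsub>N\<^esub> t) \<in> T \<rightarrow> carrier N"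
      "(\<Oplus>\<^bsub>N\<^esub>t\<in>T. d t \<odot>\<^bsub>N\<^esub> t) \<in> carrier N"
      using T by (force simp: e_def Pi_iff intro!: N.M.finsum_closed)+
    have "(\<Oplus>\<^bsub>N\<^esub>s\<in>insert a S. c s \<odot>\<^bsub>N\<^esub> h s) = c a \<odot>\<^bsub>N\<^esub> h a \<oplus>\<^bsub>N\<^esub> (\<Oplus>\<^bsub>N\<^esub>t\<in>h ` S. d t \<odot>\<^bsub>N\<^esub> t)"
      using insert.hyps a S d(2) by (subst N.M.finsum_insert) auto
    also have "\<dots> = e (h a) \<odot>\<^bsub>N\<^esub> h a \<oplus>\<^bsub>N\<^esub> (\<Oplus>\<^bsub>N\<^esub>t\<in>T. e t \<odot>\<^bsub>N\<^esub> t)"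
    proof (cases "h a \<in> h ` S")
      case True
      then have da: "d (h a) \<in> carrier \<Lambda>" and img: "h ` S = insert (h a) T"
        using d by (auto simp: T_def)
      have "(\<Oplus>\<^bsub>N\<^esub>t\<in>h ` S. d t \<odot>\<^bsub>N\<^esub> t) = d (h a) \<odot>\<^bsub>N\<^esub> h a \<oplus>\<^bsub>N\<^esub> (\<Oplus>\<^bsub>N\<^esub>t\<in>T. d t \<odot>\<^bsub>N\<^esub> t)"
        unfolding img using T Tc a da by (subst N.M.finsum_insert) auto
      then show ?thesis
        using True a da Tc by (simp add: rest) (simp add: e_def N.smult_l_distr N.M.a_assoc)
    next
      case False
      then have "h ` S = T" by (auto simp: T_def)
      then show ?thesis using False rest by (simp add: e_def)
    qed
    also have "\<dots> = (\<Oplus>\<^bsub>N\<^esub>t\<in>insert (h a) T. e t \<odot>\<^bsub>N\<^esub> t)"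
      using T Tc a ea by (subst N.M.finsum_insert) auto
    also have "insert (h a) T = h ` insert a S" by (auto simp: T_def)
    finally show ?case using e by blast
  qed
qed

text \<open>Generators of \<open>M\<close> go to generators of \<open>N\<close>. The kernel of
  \<open>\<sigma>\<close>, being the image of \<open>f\<close>, is finitely generated for this
  reason, which lifting along \<open>f\<close> presupposes.\<close>

lemma fg_module_image:
  assumes M: "fg_module \<Lambda> M" and N: "right_module \<Lambda> N"
    and h: "h \<in> mod_hom \<Lambda> M N" "h ` carrier M = carrier N"
  shows "fg_module \<Lambda> N"
proof -
  have rM: "right_module \<Lambda> M" using M by (simp add: fg_module_def)
  interpret M: right_module \<Lambda> M by fact
  obtain S where S: "finite S" "S \<subseteq> carrier M"
    "\<And>x. x \<in> carrier M \<Longrightarrow> \<exists>c\<in>S \<rightarrow> carrier \<Lambda>. x = (\<Oplus>\<^bsub>M\<^esub>s\<in>S. c s \<odot>\<^bsub>M\<^esub> s)"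
    using M unfolding fg_module_def finitely_generated_def by blast
  have "\<exists>d\<in>h ` S \<rightarrow> carrier \<Lambda>. y = (\<Oplus>\<^bsub>N\<^esub>t\<in>h ` S. d t \<odot>\<^bsub>N\<^esub> t)" if "y \<in> carrier N" for y
  proof -
    obtain x where x: "x \<in> carrier M" "y = h x" using \<open>y \<in> carrier N\<close> h(2) by blast
    obtain c where c: "c \<in> S \<rightarrow> carrier \<Lambda>" "x = (\<Oplus>\<^bsub>M\<^esub>s\<in>S. c s \<odot>\<^bsub>M\<^esub> s)" using S(3) x by blast
    interpret N: right_module \<Lambda> N by fact
    have hS: "h \<in> S \<rightarrow> carrier N" using S(2) mod_hom_closed[OF h(1)] by auto
    have "y = (\<Oplus>\<^bsub>N\<^esub>s\<in>S. h (c s \<odot>\<^bsub>M\<^esub> s))"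
      unfolding x(2) c(2) using c(1) S(2) by (intro mod_hom_finsum[OF rM N h(1) S(1)]) auto
    also have "\<dots> = (\<Oplus>\<^bsub>N\<^esub>s\<in>S. c s \<odot>\<^bsub>N\<^esub> h s)"
      using c(1) S(2) hS by (intro N.M.finsum_cong') (auto intro!: mod_hom_smult[OF h(1)])
    finally show ?thesis using finsum_smult_image[OF N S(1) hS c(1)] by simp
  qed
  moreover have "finite (h ` S)" "h ` S \<subseteq> carrier N" using S(1,2) h(2) by auto
  ultimately show ?thesis using N unfolding fg_module_def finitely_generated_def by blast
qed

lemma submodule_mod_hom_image:
  assumes "right_module \<Lambda> M" "right_module \<Lambda> N" "h \<in> mod_hom \<Lambda> M N"
  shows "submodule (h ` carrier M) \<Lambda> N"
proof -
  interpret M: right_module \<Lambda> M by fact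
  interpret N: right_module \<Lambda> N by fact
  note hc = mod_hom_closed[OF assms(3)]
  have neg: "\<ominus>\<^bsub>N\<^esub> h x = h (\<ominus>\<^bsub>M\<^esub> x)" if x: "x \<in> carrier M" for x
  proof -
    have "h (\<ominus>\<^bsub>M\<^esub> x) \<oplus>\<^bsub>N\<^esub> h x = \<zero>\<^bsub>N\<^esub>"
      using x mod_hom_add[OF assms(3), of "\<ominus>\<^bsub>M\<^esub> x" x] mod_hom_zero[OF assms]
      by (simp add: M.M.l_neg)
    then show ?thesis using x hc N.M.minus_equality by simp
  qed
  show ?thesis
  proof (intro submodule.intro subgroup.intro submodule_axioms.intro)
    fix x y assume "x \<in> h ` carrier M" "y \<in> h ` carrier M"
    then show "x \<otimes>\<^bsub>add_monoid N\<^esub> y \<in> h ` carrier M"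
      by (auto simp: mod_hom_add[OF assms(3), symmetric])
  next
    show "\<one>\<^bsub>add_monoid N\<^esub> \<in> h ` carrier M"
      using mod_hom_zero[OF assms] M.M.zero_closed by (metis imageI monoid.simps(2))
  next
    fix x assume "x \<in> h ` carrier M"
    then show "inv\<^bsub>add_monoid N\<^esub> x \<in> h ` carrier M"
      using neg by (auto simp: a_inv_def[symmetric])
  next
    fix a x assume "a \<in> carrier \<Lambda>" "x \<in> h ` carrier M"
    then show "a \<odot>\<^bsub>N\<^esub> x \<in> h ` carrier M"
      by (auto simp: mod_hom_smult[OF assms(3), symmetric])
  qed (use hc in auto)
qed

section \<open>Endomorphisms of projective covers\<close>

text \<open>For each \<open>x\<close> there is some \<open>y\<close> with
  \<open>h x = \<alpha> (h y) = h (\<gamma> y)\<close>, so \<open>x\<close> and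
  \<open>\<gamma> y\<close> differ by an element of the kernel of \<open>h\<close>. Hence this
  kernel and the image of \<open>\<gamma>\<close> span \<open>P\<close>, and superfluity makes the
  image all of \<open>P\<close>. As \<open>\<alpha>\<close> is a mere function, a set-theoretic
  inverse can take its place.\<close>

lemma projective_cover_surj:
  assumes cov: "projective_cover \<Lambda> P h N" and N: "right_module \<Lambda> N"
    and \<gamma>: "\<gamma> \<in> mod_hom \<Lambda> P P" and \<alpha>: "carrier N \<subseteq> \<alpha> ` carrier N"
    and comm: "\<And>x. x \<in> carrier P \<Longrightarrow> h (\<gamma> x) = \<alpha> (h x)"
  shows "\<gamma> ` carrier P = carrier P"
proof -
  have P: "right_module \<Lambda> P" and h: "h \<in> mod_hom \<Lambda> P N" "h ` carrier P = carrier N"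
    and sup: "superfluous \<Lambda> (a_kernel P N h) P"
    using cov by (auto simp: projective_cover_def projective_def fg_module_def)
  interpret P: right_module \<Lambda> P by fact
  interpret N: right_module \<Lambda> N by fact
  note hc = mod_hom_closed[OF h(1)] and gc = mod_hom_closed[OF \<gamma>]
  have "a_kernel P N h <+>\<^bsub>P\<^esub> \<gamma> ` carrier P = carrier P"
  proof (intro equalityI subsetI)
    fix x assume x: "x \<in> carrier P"
    obtain z where z: "z \<in> carrier N" "h x = \<alpha> z" using hc[OF x] \<alpha> by blast
    then obtain y where y: "y \<in> carrier P" "z = h y" using h(2) by blast
    have eq: "h (\<gamma> y) = h x" using comm y z by simp
    define k where "k = x \<ominus>\<^bsub>P\<^esub> \<gamma> y"
    have k: "k \<in> carrier P" "k \<oplus>\<^bsub>P\<^esub> \<gamma> y = x"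
      using x gc[OF y(1)] by (auto simp: k_def a_minus_def P.M.a_assoc P.M.l_neg)
    then have "h k \<oplus>\<^bsub>N\<^esub> h x = h x"
      using mod_hom_add[OF h(1) k(1) gc[OF y(1)]] eq by simp
    then have "h k = \<zero>\<^bsub>N\<^esub>" using hc k x by (metis N.M.add.r_cancel_one)
    then have "k \<in> a_kernel P N h" using k by (simp add: a_kernel_def' )
    then show "x \<in> a_kernel P N h <+>\<^bsub>P\<^esub> \<gamma> ` carrier P"
      using k(2)[symmetric] y(1) unfolding set_add_def' by blast
  qed (use gc in \<open>auto simp: set_add_def' a_kernel_def'\<close>)
  then show ?thesis
    using sup submodule_mod_hom_image[OF P P \<gamma>] unfolding superfluous_def by blast
qed

text \<open>Records an inverse homomorphism instead of bijectivity, because the inverse of a pair in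
  \<open>H_automorphism\<close> is assembled from the inverses of its components.\<close>

definition mod_automorphism :: "('a, 'z) ring_scheme \<Rightarrow> ('a, 'b) module \<Rightarrow> ('b \<Rightarrow> 'b) \<Rightarrow> bool" where
  "mod_automorphism \<Lambda> P \<gamma> \<longleftrightarrow> \<gamma> \<in> mod_hom \<Lambda> P P \<and>
     (\<exists>\<delta>\<in>mod_hom \<Lambda> P P. compose (carrier P) \<delta> \<gamma> = mod_id P \<and> compose (carrier P) \<gamma> \<delta> = mod_id P)"

lemma mod_automorphismE:
  assumes "mod_automorphism \<Lambda> P \<gamma>"
  obtains \<delta> where "\<delta> \<in> mod_hom \<Lambda> P P"
    "\<And>x. x \<in> carrier P \<Longrightarrow> \<delta> (\<gamma> x) = x" "\<And>x. x \<in> carrier P \<Longrightarrow> \<gamma> (\<delta> x) = x"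
proof -
  obtain \<delta> where \<delta>: "\<delta> \<in> mod_hom \<Lambda> P P"
    "compose (carrier P) \<delta> \<gamma> = mod_id P" "compose (carrier P) \<gamma> \<delta> = mod_id P"
    using assms by (auto simp: mod_automorphism_def)
  show ?thesis
    using that[OF \<delta>(1)] fun_cong[OF \<delta>(2)] fun_cong[OF \<delta>(3)]
    by (simp add: compose_def mod_id_def) metis
qed

lemma mod_automorphismI:
  assumes "\<gamma> \<in> mod_hom \<Lambda> P P" "\<delta> \<in> mod_hom \<Lambda> P P"
    "\<And>x. x \<in> carrier P \<Longrightarrow> \<delta> (\<gamma> x) = x" "\<And>x. x \<in> carrier P \<Longrightarrow> \<gamma> (\<delta> x) = x"
  shows "mod_automorphism \<Lambda> P \<gamma>"
  unfolding mod_automorphism_def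
  using assms by (auto simp: compose_def mod_id_def intro!: bexI[of _ \<delta>])

text \<open>A general bijection \<open>\<alpha>\<close> is allowed for the sake of \<open>f\<close>:
  there an endomorphism of \<open>P\<^sub>1\<close> induces on the kernel of \<open>\<sigma>\<close>
  the restriction of an automorphism of \<open>P\<^sub>0\<close>, which may differ from the
  identity.\<close>

lemma projective_cover_automorphism:
  assumes cov: "projective_cover \<Lambda> P h N" and N: "right_module \<Lambda> N"
    and \<gamma>: "\<gamma> \<in> mod_hom \<Lambda> P P" and \<alpha>: "bij_betw \<alpha> (carrier N) (carrier N)"
    and comm: "\<And>x. x \<in> carrier P \<Longrightarrow> h (\<gamma> x) = \<alpha> (h x)"
  shows "mod_automorphism \<Lambda> P \<gamma>"
proof -
  have pr: "projective \<Lambda> P" and fg: "fg_module \<Lambda> P" and P: "right_module \<Lambda> P"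
    and h: "h \<in> mod_hom \<Lambda> P N"
    using cov by (auto simp: projective_cover_def projective_def fg_module_def)
  have surj: "\<gamma> ` carrier P = carrier P"
    using projective_cover_surj[OF cov N \<gamma> _ comm] \<alpha> by (simp add: bij_betw_def)
  obtain s where s: "s \<in> mod_hom \<Lambda> P P" "compose (carrier P) \<gamma> s = mod_id P"
    using projective_lift[OF pr fg fg \<gamma> surj mod_id_mod_hom[OF P]] .
  have \<gamma>s: "\<gamma> (s x) = x" if "x \<in> carrier P" for x
    using fun_cong[OF s(2), of x] that by (simp add: compose_def mod_id_def)
  note sc = mod_hom_closed[OF s(1)]
  \<comment> \<open>By \<open>comm\<close> at \<open>s x\<close>, the section \<open>s\<close>
    induces the inverse of \<open>\<alpha>\<close> on \<open>N\<close>, so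
    \<open>projective_cover_surj\<close> applies to \<open>s\<close> as well.\<close>
  have "h (s x) = the_inv_into (carrier N) \<alpha> (h x)" if x: "x \<in> carrier P" for x
  proof -
    have "\<alpha> (h (s x)) = h x" using comm[OF sc[OF x]] \<gamma>s[OF x] by simp
    then show ?thesis
      using \<alpha> mod_hom_closed[OF h sc[OF x]] by (metis bij_betw_def the_inv_into_f_f)
  qed
  then have "s ` carrier P = carrier P"
    using bij_betw_the_inv_into[OF \<alpha>]
    by (intro projective_cover_surj[OF cov N s(1), where \<alpha> = "the_inv_into (carrier N) \<alpha>"])
      (auto simp: bij_betw_def)
  \<comment> \<open>Writing \<open>x = s y\<close> gives
    \<open>s (\<gamma> x) = s (\<gamma> (s y)) = s y = x\<close>, so the section is a two-sided
    inverse.\<close>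
  then have "s (\<gamma> x) = x" if "x \<in> carrier P" for x using that \<gamma>s by (metis imageE)
  then show ?thesis using mod_automorphismI[OF \<gamma> s(1)] \<gamma>s by blast
qed

section \<open>Componentwise reasoning in the morphism category\<close>

lemma H_hom_iff:
  "(u, v) \<in> H_hom \<Lambda> X Y \<longleftrightarrow> u \<in> mod_hom \<Lambda> (src X) (src Y) \<and> v \<in> mod_hom \<Lambda> (tgt X) (tgt Y) \<and>
     (\<forall>x\<in>carrier (src X). v (arr X x) = arr Y (u x))"
  by (auto simp: H_hom_def compose_def fun_eq_iff)

text \<open>\<open>compose\<close> returns \<open>undefined\<close> off the carrier, so
  extensionality of \<open>u\<close> and \<open>v\<close> is what reduces the equation to values on
  the carriers.\<close>

lemma H_comp_eq_iff:
  assumes "u \<in> extensional (carrier (src X))" "v \<in> extensional (carrier (tgt X))"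
  shows "(u, v) = H_comp X (p, q) (r, s) \<longleftrightarrow>
    (\<forall>x\<in>carrier (src X). u x = p (r x)) \<and> (\<forall>x\<in>carrier (tgt X). v x = q (s x))"
  using assms by (auto simp: H_comp_def compose_def fun_eq_iff extensional_def)

lemma mod_hom_extensional: "h \<in> mod_hom \<Lambda> M N \<Longrightarrow> h \<in> extensional (carrier M)"
  by (auto simp: mod_hom_def PiE_def)

text \<open>The inverses of the components again form a commutative square: the square of
  \<open>(u, v)\<close> at \<open>u' x\<close> gives \<open>v (arr X (u' x)) = arr X x\<close>, and
  applying \<open>v'\<close> cancels \<open>v\<close>.\<close>

lemma H_automorphism_componentwise:
  assumes X: "H_obj \<Lambda> X" and \<gamma>: "(u, v) \<in> H_hom \<Lambda> X X"
    and u: "mod_automorphism \<Lambda> (src X) u" and v: "mod_automorphism \<Lambda> (tgt X) v"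
  shows "H_automorphism \<Lambda> X (u, v)"
proof -
  obtain u' where u': "u' \<in> mod_hom \<Lambda> (src X) (src X)"
    "\<And>x. x \<in> carrier (src X) \<Longrightarrow> u' (u x) = x" "\<And>x. x \<in> carrier (src X) \<Longrightarrow> u (u' x) = x"
    using mod_automorphismE[OF u] by blast
  obtain v' where v': "v' \<in> mod_hom \<Lambda> (tgt X) (tgt X)"
    "\<And>x. x \<in> carrier (tgt X) \<Longrightarrow> v' (v x) = x" "\<And>x. x \<in> carrier (tgt X) \<Longrightarrow> v (v' x) = x"
    using mod_automorphismE[OF v] by blast
  have ar: "arr X \<in> mod_hom \<Lambda> (src X) (tgt X)" using X by (simp add: H_obj_def)
  have "v' (arr X x) = arr X (u' x)" if x: "x \<in> carrier (src X)" for x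
  proof -
    have c: "u' x \<in> carrier (src X)" using mod_hom_closed[OF u'(1) x] .
    then have "v (arr X (u' x)) = arr X x" using \<gamma> u'(3)[OF x] by (simp add: H_hom_iff)
    then show ?thesis using v'(2) mod_hom_closed[OF ar c] by metis
  qed
  then have "(u', v') \<in> H_hom \<Lambda> X X" using u'(1) v'(1) by (simp add: H_hom_iff)
  moreover have "H_comp X (u', v') (u, v) = H_id X" "H_comp X (u, v) (u', v') = H_id X"
    using u' v' by (auto simp: H_comp_def H_id_def mod_id_def compose_def)
  ultimately show ?thesis using \<gamma> unfolding H_automorphism_def by blast
qed

text \<open>The type \<open>unit\<close> has a single element, so \<open>v\<close> serves as its own
  inverse.\<close>

lemma zero_module_automorphism:
  fixes v :: "unit \<Rightarrow> unit"
  assumes "v \<in> mod_hom \<Lambda> zero_module zero_module"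
  shows "mod_automorphism \<Lambda> zero_module v"
  by (rule mod_automorphismI[OF assms assms]) auto

lemma projective_cover_lift:
  assumes cov: "projective_cover \<Lambda> P h N" and N: "fg_module \<Lambda> N"
    and Q: "projective \<Lambda> Q" and \<phi>: "\<phi> \<in> mod_hom \<Lambda> Q N"
  obtains \<psi> where "\<psi> \<in> mod_hom \<Lambda> Q P" "\<And>x. x \<in> carrier Q \<Longrightarrow> h (\<psi> x) = \<phi> x"
proof -
  have P: "fg_module \<Lambda> P" and h: "h \<in> mod_hom \<Lambda> P N" "h ` carrier P = carrier N"
    using cov by (auto simp: projective_cover_def projective_def)
  obtain \<psi> where \<psi>: "\<psi> \<in> mod_hom \<Lambda> Q P" "compose (carrier Q) h \<psi> = \<phi>"
    using projective_lift[OF Q P N h \<phi>] .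
  show ?thesis using that[OF \<psi>(1)] \<psi>(2) by (auto simp: compose_def)
qed

section \<open>Minimal approximations obtained from the presentation of \<open>M\<close>\<close>

theorem lemma3p2:
  fixes R :: "'r ring" and \<Lambda> :: "('r, 'a) module"
    and M :: "('a, 'm) module" and P\<^sub>0 :: "('a, 'p) module" and P\<^sub>1 :: "('a, 'q) module"
    and f :: "'q \<Rightarrow> 'p" and \<sigma> :: "'p \<Rightarrow> 'm"
  assumes "artin_algebra R \<Lambda>"
    and "fg_module \<Lambda> M" and "indecomposable \<Lambda> M"
    and "minimal_projective_presentation \<Lambda> P\<^sub>1 f P\<^sub>0 \<sigma> M"
  shows "right_minimal_P_approximation \<Lambda>
           (Mor P\<^sub>1 P\<^sub>0 f) (Mor zero_module M (zero_map zero_module M)) (zero_map P\<^sub>1 zero_module, \<sigma>)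
       \<and> right_minimal_P_approximation \<Lambda>
           (Mor P\<^sub>0 P\<^sub>0 (mod_id P\<^sub>0)) (Mor M M (mod_id M)) (\<sigma>, \<sigma>)
       \<and> right_minimal_P_approximation \<Lambda>
           (Mor P\<^sub>0 zero_module (zero_map P\<^sub>0 zero_module)) (Mor M zero_module (zero_map M zero_module))
           (\<sigma>, zero_map zero_module zero_module)"
proof -
  let ?Z = "zero_module :: ('a, unit) module"
  \<comment> \<open>The kernel of \<open>\<sigma>\<close> with the operations of
    \<open>P\<^sub>0\<close>; it is the module covered by \<open>f\<close>.\<close>
  define K where "K = P\<^sub>0\<lparr>carrier := a_kernel P\<^sub>0 M \<sigma>\<rparr>"
  have cov0: "projective_cover \<Lambda> P\<^sub>0 \<sigma> M" and cov1: "projective_cover \<Lambda> P\<^sub>1 f K"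
    using assms(4) by (auto simp: minimal_projective_presentation_def K_def)
  have pr: "projective \<Lambda> P\<^sub>0" "projective \<Lambda> P\<^sub>1" and fg: "fg_module \<Lambda> P\<^sub>0" "fg_module \<Lambda> P\<^sub>1"
    and \<sigma>: "\<sigma> \<in> mod_hom \<Lambda> P\<^sub>0 M" "\<sigma> ` carrier P\<^sub>0 = carrier M"
    and f: "f \<in> mod_hom \<Lambda> P\<^sub>1 K" "f ` carrier P\<^sub>1 = carrier K"
    and K_sub: "submodule (a_kernel P\<^sub>0 M \<sigma>) \<Lambda> P\<^sub>0"
    using cov0 cov1 by (auto simp: projective_cover_def projective_def superfluous_def)
  have ring: "ring \<Lambda>" using assms(1) by (simp add: artin_algebra_def)
  have rm: "right_module \<Lambda> P\<^sub>0" "right_module \<Lambda> P\<^sub>1" "right_module \<Lambda> M"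
    using fg assms(2) by (auto simp: fg_module_def)
  note rZ = right_module_zero_module[OF ring] and fZ = fg_module_zero_module[OF ring]
    and pZ = projective_zero_module[OF ring]
  have rK: "right_module \<Lambda> K" unfolding K_def by (rule right_module_submodule[OF rm(1) K_sub])
  have fgK: "fg_module \<Lambda> K" by (rule fg_module_image[OF fg(2) rK f])
  have K: "x \<in> carrier K \<longleftrightarrow> x \<in> carrier P\<^sub>0 \<and> \<sigma> x = \<zero>\<^bsub>M\<^esub>" for x
    by (auto simp: K_def a_kernel_def')
  \<comment> \<open>Used in both directions: to read \<open>f\<close> as a map into
    \<open>P\<^sub>0\<close> killed by \<open>\<sigma>\<close>, and to see that a map into
    \<open>P\<^sub>0\<close> lands in the kernel.\<close>
  have mod_hom_K: "g \<in> mod_hom \<Lambda> Q K \<longleftrightarrow>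
      g \<in> mod_hom \<Lambda> Q P\<^sub>0 \<and> (\<forall>x\<in>carrier Q. \<sigma> (g x) = \<zero>\<^bsub>M\<^esub>)" for g and Q :: "('a, 'x) module"
    by (auto simp: mod_hom_def PiE_iff K) (auto simp: K_def)
  have f0: "f \<in> mod_hom \<Lambda> P\<^sub>1 P\<^sub>0" "\<And>x. x \<in> carrier P\<^sub>1 \<Longrightarrow> \<sigma> (f x) = \<zero>\<^bsub>M\<^esub>"
    using f(1) by (auto simp: mod_hom_K)
  \<comment> \<open>Such a \<open>\<gamma>\<close> induces the identity on \<open>M\<close>.\<close>
  have auto0: "mod_automorphism \<Lambda> P\<^sub>0 \<gamma>"
    if "\<gamma> \<in> mod_hom \<Lambda> P\<^sub>0 P\<^sub>0" "\<And>x. x \<in> carrier P\<^sub>0 \<Longrightarrow> \<sigma> (\<gamma> x) = \<sigma> x" for \<gamma>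
    using that by (intro projective_cover_automorphism[OF cov0 rm(3), where \<alpha> = id]) auto
  \<comment> \<open>Both \<open>\<beta>\<close> and its inverse \<open>\<delta>\<close> preserve
    \<open>\<sigma>\<close>, so they restrict to mutually inverse maps of \<open>K\<close>; by
    \<open>comm\<close>, this restriction of \<open>\<beta>\<close> is what \<open>\<gamma>\<close>
    induces along \<open>f\<close>.\<close>
  have auto1: "mod_automorphism \<Lambda> P\<^sub>1 \<gamma>"
    if \<gamma>: "\<gamma> \<in> mod_hom \<Lambda> P\<^sub>1 P\<^sub>1" and \<beta>: "mod_automorphism \<Lambda> P\<^sub>0 \<beta>"
      and \<sigma>\<beta>: "\<And>x. x \<in> carrier P\<^sub>0 \<Longrightarrow> \<sigma> (\<beta> x) = \<sigma> x"
      and comm: "\<And>x. x \<in> carrier P\<^sub>1 \<Longrightarrow> \<beta> (f x) = f (\<gamma> x)" for \<gamma> \<beta>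
  proof -
    obtain \<delta> where \<delta>: "\<delta> \<in> mod_hom \<Lambda> P\<^sub>0 P\<^sub>0"
      "\<And>x. x \<in> carrier P\<^sub>0 \<Longrightarrow> \<delta> (\<beta> x) = x" "\<And>x. x \<in> carrier P\<^sub>0 \<Longrightarrow> \<beta> (\<delta> x) = x"
      using mod_automorphismE[OF \<beta>] by blast
    have \<beta>': "\<beta> \<in> mod_hom \<Lambda> P\<^sub>0 P\<^sub>0" using \<beta> by (simp add: mod_automorphism_def)
    have \<sigma>\<delta>: "\<sigma> (\<delta> x) = \<sigma> x" if "x \<in> carrier P\<^sub>0" for x
      using \<sigma>\<beta>[of "\<delta> x"] \<delta> that mod_hom_closed[OF \<delta>(1)] by simp
    have "bij_betw \<beta> (carrier K) (carrier K)"
      using \<delta> \<sigma>\<beta> \<sigma>\<delta> mod_hom_closed[OF \<delta>(1)] mod_hom_closed[OF \<beta>']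
      by (intro bij_betw_byWitness[where f' = \<delta>]) (auto simp: K)
    then show ?thesis
      using comm by (intro projective_cover_automorphism[OF cov1 rK \<gamma>]) auto
  qed

  \<comment> \<open>(1): approximation of 0 -> M\<close>
  let ?X1 = "Mor P\<^sub>1 P\<^sub>0 f" and ?Y1 = "Mor ?Z M (zero_map ?Z M)"
  have "right_P_approximation \<Lambda> ?X1 ?Y1 (zero_map P\<^sub>1 ?Z, \<sigma>)"
    unfolding right_P_approximation_def
  proof (intro conjI allI impI ballI)
    show "P_obj \<Lambda> ?X1" using pr fg f0 by (simp add: P_obj_def H_obj_def)
    show "H_obj \<Lambda> ?Y1" using fZ assms(2) zero_map_mod_hom[OF rZ rm(3)] by (simp add: H_obj_def)
    show "(zero_map P\<^sub>1 ?Z, \<sigma>) \<in> H_hom \<Lambda> ?X1 ?Y1"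
      using zero_map_mod_hom[OF rm(2) rZ] \<sigma> f0
      by (simp add: H_hom_iff) (simp add: zero_map_def zero_module_def)
    fix Q :: "('a, (nat \<Rightarrow> 'a) set, (nat \<Rightarrow> 'a) set) mor" and \<phi>
    assume Q: "P_obj \<Lambda> Q" and \<phi>: "\<phi> \<in> H_hom \<Lambda> Q ?Y1"
    obtain p q where pq: "\<phi> = (p, q)" by fastforce
    have prQ: "projective \<Lambda> (src Q)" "projective \<Lambda> (tgt Q)" and g: "arr Q \<in> mod_hom \<Lambda> (src Q) (tgt Q)"
      and rQ: "right_module \<Lambda> (src Q)"
      using Q by (auto simp: P_obj_def H_obj_def fg_module_def)
    have p: "p \<in> mod_hom \<Lambda> (src Q) ?Z" and q: "q \<in> mod_hom \<Lambda> (tgt Q) M"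
      and qg: "\<And>x. x \<in> carrier (src Q) \<Longrightarrow> q (arr Q x) = \<zero>\<^bsub>M\<^esub>"
      using \<phi> by (auto simp: pq H_hom_iff zero_map_def zero_module_def)
    \<comment> \<open>First \<open>q\<close> is lifted through \<open>\<sigma>\<close>. As
      \<open>q\<close> vanishes on the image of \<open>arr Q\<close>, the composite of
      \<open>v\<close> with \<open>arr Q\<close> lands in \<open>K\<close>, and lifting it through
      \<open>f\<close> yields the \<open>u\<close> that completes the square.\<close>
    obtain v where v: "v \<in> mod_hom \<Lambda> (tgt Q) P\<^sub>0" "\<And>x. x \<in> carrier (tgt Q) \<Longrightarrow> \<sigma> (v x) = q x"
      using projective_cover_lift[OF cov0 assms(2) prQ(2) q] by blast
    have "compose (carrier (src Q)) v (arr Q) \<in> mod_hom \<Lambda> (src Q) K"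
      using mod_hom_compose[OF rQ v(1) g] v(2) qg mod_hom_closed[OF g]
      by (simp add: mod_hom_K compose_def)
    then obtain u where u: "u \<in> mod_hom \<Lambda> (src Q) P\<^sub>1"
      "\<And>x. x \<in> carrier (src Q) \<Longrightarrow> f (u x) = compose (carrier (src Q)) v (arr Q) x"
      using projective_cover_lift[OF cov1 fgK prQ(1)] by blast
    have "(u, v) \<in> H_hom \<Lambda> Q ?X1" using u v by (simp add: H_hom_iff compose_def)
    moreover have "\<phi> = H_comp Q (zero_map P\<^sub>1 ?Z, \<sigma>) (u, v)"
      unfolding pq using v(2) p q by (subst H_comp_eq_iff) (auto dest: mod_hom_extensional)
    ultimately show "\<exists>\<psi>\<in>H_hom \<Lambda> Q ?X1. \<phi> = H_comp Q (zero_map P\<^sub>1 ?Z, \<sigma>) \<psi>" by blast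
  qed
  moreover have "right_minimal \<Lambda> ?X1 (zero_map P\<^sub>1 ?Z, \<sigma>)"
    unfolding right_minimal_def
  proof (intro ballI impI)
    fix \<gamma> assume \<gamma>: "\<gamma> \<in> H_hom \<Lambda> ?X1 ?X1" "H_comp ?X1 (zero_map P\<^sub>1 ?Z, \<sigma>) \<gamma> = (zero_map P\<^sub>1 ?Z, \<sigma>)"
    obtain u v where uv: "\<gamma> = (u, v)" by fastforce
    have u: "u \<in> mod_hom \<Lambda> P\<^sub>1 P\<^sub>1" and v: "v \<in> mod_hom \<Lambda> P\<^sub>0 P\<^sub>0"
      and sq: "\<And>x. x \<in> carrier P\<^sub>1 \<Longrightarrow> v (f x) = f (u x)" using \<gamma>(1) by (auto simp: uv H_hom_iff)
    \<comment> \<open>The first component of the equation takes values in the zero module and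
      carries no information. The second makes \<open>v\<close> an automorphism, and
      \<open>sq\<close> then passes this on to \<open>u\<close> by \<open>auto1\<close>.\<close>
    have \<sigma>v: "\<sigma> (v x) = \<sigma> x" if "x \<in> carrier P\<^sub>0" for x
      using \<gamma>(2) that by (auto simp: uv H_comp_def compose_def fun_eq_iff split: if_splits)
    have "mod_automorphism \<Lambda> P\<^sub>0 v" by (rule auto0[OF v \<sigma>v])
    then show "H_automorphism \<Lambda> ?X1 \<gamma>"
      using auto1[OF u _ \<sigma>v sq] \<gamma>(1) fg f0 unfolding uv
      by (intro H_automorphism_componentwise) (auto simp: H_obj_def)
  qed

  \<comment> \<open>(2): approximation of the identity of \<open>M\<close>\<close>
  moreover
  let ?X2 = "Mor P\<^sub>0 P\<^sub>0 (mod_id P\<^sub>0)" and ?Y2 = "Mor M M (mod_id M)"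
  have X2: "P_obj \<Lambda> ?X2" using pr fg mod_id_mod_hom[OF rm(1)] by (simp add: P_obj_def H_obj_def)
  have "right_P_approximation \<Lambda> ?X2 ?Y2 (\<sigma>, \<sigma>)"
    unfolding right_P_approximation_def
  proof (intro conjI allI impI ballI)
    show "P_obj \<Lambda> ?X2" by (rule X2)
    show "H_obj \<Lambda> ?Y2" using assms(2) mod_id_mod_hom[OF rm(3)] by (simp add: H_obj_def)
    show "(\<sigma>, \<sigma>) \<in> H_hom \<Lambda> ?X2 ?Y2"
      using \<sigma> mod_hom_closed[OF \<sigma>(1)] by (simp add: H_hom_iff mod_id_def)
    fix Q :: "('a, (nat \<Rightarrow> 'a) set, (nat \<Rightarrow> 'a) set) mor" and \<phi>
    assume Q: "P_obj \<Lambda> Q" and \<phi>: "\<phi> \<in> H_hom \<Lambda> Q ?Y2"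
    obtain p q where pq: "\<phi> = (p, q)" by fastforce
    have prQ: "projective \<Lambda> (tgt Q)" and g: "arr Q \<in> mod_hom \<Lambda> (src Q) (tgt Q)"
      and rQ: "right_module \<Lambda> (src Q)"
      using Q by (auto simp: P_obj_def H_obj_def fg_module_def)
    have p: "p \<in> mod_hom \<Lambda> (src Q) M" and q: "q \<in> mod_hom \<Lambda> (tgt Q) M" using \<phi>
      by (auto simp: pq H_hom_iff)
    have qg: "q (arr Q x) = p x" if "x \<in> carrier (src Q)" for x
      using \<phi> that mod_hom_closed[OF p] by (simp add: pq H_hom_iff mod_id_def)
    obtain v where v: "v \<in> mod_hom \<Lambda> (tgt Q) P\<^sub>0" "\<And>x. x \<in> carrier (tgt Q) \<Longrightarrow> \<sigma> (v x) = q x"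
      using projective_cover_lift[OF cov0 assms(2) prQ q] by blast
    \<comment> \<open>The arrow of \<open>?X2\<close> is an identity, so the square forces this
      first component. It lifts \<open>p\<close> because
      \<open>\<sigma> (v (arr Q x)) = q (arr Q x) = p x\<close>.\<close>
    let ?u = "compose (carrier (src Q)) v (arr Q)"
    have "(?u, v) \<in> H_hom \<Lambda> Q ?X2"
      using mod_hom_compose[OF rQ v(1) g] v(1) mod_hom_closed[OF g] mod_hom_closed[OF v(1)]
      by (simp add: H_hom_iff mod_id_def compose_def)
    moreover have "\<phi> = H_comp Q (\<sigma>, \<sigma>) (?u, v)"
      unfolding pq using v(2) p q qg mod_hom_closed[OF g]
      by (subst H_comp_eq_iff) (auto dest: mod_hom_extensional simp: compose_def)
    ultimately show "\<exists>\<psi>\<in>H_hom \<Lambda> Q ?X2. \<phi> = H_comp Q (\<sigma>, \<sigma>) \<psi>" by blast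
  qed
  moreover have "right_minimal \<Lambda> ?X2 (\<sigma>, \<sigma>)"
    unfolding right_minimal_def
  proof (intro ballI impI)
    fix \<gamma> assume \<gamma>: "\<gamma> \<in> H_hom \<Lambda> ?X2 ?X2" "H_comp ?X2 (\<sigma>, \<sigma>) \<gamma> = (\<sigma>, \<sigma>)"
    obtain u v where uv: "\<gamma> = (u, v)" by fastforce
    have uv': "u \<in> mod_hom \<Lambda> P\<^sub>0 P\<^sub>0" "v \<in> mod_hom \<Lambda> P\<^sub>0 P\<^sub>0" using \<gamma>(1) by (auto simp: uv H_hom_iff)
    have "\<sigma> (u x) = \<sigma> x" "\<sigma> (v x) = \<sigma> x" if "x \<in> carrier P\<^sub>0" for x
      using \<gamma>(2) that by (auto simp: uv H_comp_def compose_def fun_eq_iff split: if_splits)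
    then show "H_automorphism \<Lambda> ?X2 \<gamma>"
      using auto0 uv' \<gamma>(1) X2 unfolding uv
      by (intro H_automorphism_componentwise) (auto simp: P_obj_def)
  qed

  \<comment> \<open>(3): approximation of M -> 0\<close>
  moreover
  let ?X3 = "Mor P\<^sub>0 ?Z (zero_map P\<^sub>0 ?Z)" and ?Y3 = "Mor M ?Z (zero_map M ?Z)"
  \<comment> \<open>The scalar type of \<open>zero_map zero_module zero_module\<close> in the statement is a type variable of its
    own, which is why the second component is an arbitrary \<open>z\<close> below.\<close>
  have X3: "P_obj \<Lambda> ?X3"
    using pr fg fZ pZ zero_map_mod_hom[OF rm(1) rZ] by (simp add: P_obj_def H_obj_def)
  have z: "z \<in> mod_hom \<Lambda> ?Z ?Z" for z
    by (auto simp: mod_hom_def zero_module_def PiE_iff extensional_def)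
  have "right_P_approximation \<Lambda> ?X3 ?Y3 (\<sigma>, z)" for z
    unfolding right_P_approximation_def
  proof (intro conjI allI impI ballI)
    show "P_obj \<Lambda> ?X3" by (rule X3)
    show "H_obj \<Lambda> ?Y3" using assms(2) fZ zero_map_mod_hom[OF rm(3) rZ] by (simp add: H_obj_def)
    show "(\<sigma>, z) \<in> H_hom \<Lambda> ?X3 ?Y3" using \<sigma> z by (simp add: H_hom_iff)
    fix Q :: "('a, (nat \<Rightarrow> 'a) set, (nat \<Rightarrow> 'a) set) mor" and \<phi>
    assume Q: "P_obj \<Lambda> Q" and \<phi>: "\<phi> \<in> H_hom \<Lambda> Q ?Y3"
    obtain p q where pq: "\<phi> = (p, q)" by fastforce
    have prQ: "projective \<Lambda> (src Q)" using Q by (simp add: P_obj_def)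
    have p: "p \<in> mod_hom \<Lambda> (src Q) M" and q: "q \<in> mod_hom \<Lambda> (tgt Q) ?Z" using \<phi>
      by (auto simp: pq H_hom_iff)
    obtain u where u: "u \<in> mod_hom \<Lambda> (src Q) P\<^sub>0" "\<And>x. x \<in> carrier (src Q) \<Longrightarrow> \<sigma> (u x) = p x"
      using projective_cover_lift[OF cov0 assms(2) prQ p] by blast
    \<comment> \<open>Both \<open>?X3\<close> and \<open>?Y3\<close> have the zero module as target,
      so \<open>q\<close> is its own lift and the square commutes for lack of any other
      value.\<close>
    have "(u, q) \<in> H_hom \<Lambda> Q ?X3" using u q by (simp add: H_hom_iff)
    moreover have "\<phi> = H_comp Q (\<sigma>, z) (u, q)"
      unfolding pq using u(2) p q by (subst H_comp_eq_iff) (auto dest: mod_hom_extensional)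
    ultimately show "\<exists>\<psi>\<in>H_hom \<Lambda> Q ?X3. \<phi> = H_comp Q (\<sigma>, z) \<psi>" by blast
  qed
  moreover have "right_minimal \<Lambda> ?X3 (\<sigma>, z)" for z
    unfolding right_minimal_def
  proof (intro ballI impI)
    fix \<gamma> assume \<gamma>: "\<gamma> \<in> H_hom \<Lambda> ?X3 ?X3" "H_comp ?X3 (\<sigma>, z) \<gamma> = (\<sigma>, z)"
    obtain u v where uv: "\<gamma> = (u, v)" by fastforce
    have uv': "u \<in> mod_hom \<Lambda> P\<^sub>0 P\<^sub>0" "v \<in> mod_hom \<Lambda> ?Z ?Z" using \<gamma>(1) by (auto simp: uv H_hom_iff)
    have "\<sigma> (u x) = \<sigma> x" if "x \<in> carrier P\<^sub>0" for x
      using \<gamma>(2) that by (auto simp: uv H_comp_def compose_def fun_eq_iff split: if_splits)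
    then show "H_automorphism \<Lambda> ?X3 \<gamma>"
      using auto0 uv' zero_module_automorphism \<gamma>(1) X3 unfolding uv
      by (intro H_automorphism_componentwise) (auto simp: P_obj_def)
  qed
  ultimately show ?thesis unfolding right_minimal_P_approximation_def by blast
qed

end
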